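(* Let $H\in(0,1)$. For $t>0$ and $\lambda\in\mathbb{R}$ define $P(t,\lambda)=\varphi(t\lambda)\sqrt{dV_t/dt}$ and $P^*(t,\lambda)=e^{i\lambda t}\,\overline{P(t,\lambda)}$. For all $T>0$ and $\omega,\lambda\in\mathbb{R}$, we have $$i(\lambda-\omega)S_T(\omega,\lambda)=\overline{P(T,\omega)}P(T,\lambda)-\overline{P^*(T,\omega)}P^*(T,\lambda).$$
   Context: $\Gamma$ is Euler's gamma function and $J_\nu$ the Bessel function of the first kind of order $\nu$. $V_t=d_H^2\,t^{2-2H}$ with $d_H^2=\dfrac{\Gamma(3/2-H)}{2H\,\Gamma(H+1/2)\,\Gamma(3-2H)}$. The function $\varphi:\mathbb{R}\to\mathbb{C}$ is $$\varphi(z)=\Gamma(1-H)\Big(\frac z4\Big)^H e^{iz/2}\Big(J_{-H}\Big(\frac z2\Big)+iJ_{1-H}\Big(\frac z2\Big)\Big)\ (z\ne0),\qquad \varphi(0)=1.$$ Here $z^{-\nu}J_\nu(z)$ is always understood as the entire even function $\sum_{k\ge0}\frac{(-1)^k 2^{-\nu}(z/2)^{2k}}{k!\,\Gamma(k+\nu+1)}$, so $z^HJ_{-H}(z)$ and $z^HJ_{1-H}(z)=z\cdot z^{-(1-H)}J_{1-H}(z)$ are entire and $\varphi$ is entire. $S_T(\omega,\lambda)=\int_0^T\overline{\varphi(u\omega)}\varphi(u\lambda)\,dV_u$ for $\omega,\lambda\in\mathbb{R}$. *)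

theory Defs
  imports "HOL-Analysis.Analysis"
begin

text \<open>The entire even function that is the meaning of \<open>z\<^sup>-\<^sup>\<nu> J\<^sub>\<nu>(z)\<close>.\<close>

definition bessel_entire :: "real \<Rightarrow> complex \<Rightarrow> complex" where
  "bessel_entire \<nu> z =
     (\<Sum>k. (-1) ^ k * of_real (2 powr (-\<nu>)) * (z / 2) ^ (2 * k)
            / (fact k * of_real (Gamma (real k + \<nu> + 1))))"

text \<open>
  The power is the principal branch. For \<open>z = 0\<close> the value is always 0, because
  \<open>0 powr a = 0\<close>; this is not the usual value when \<open>\<nu> = 0\<close>, but below
  \<open>bessel_J\<close> is only used at nonzero arguments.
\<close>

definition bessel_J :: "real \<Rightarrow> complex \<Rightarrow> complex" where
  "bessel_J \<nu> z = z powr of_real \<nu> * bessel_entire \<nu> z"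

definition phi :: "real \<Rightarrow> real \<Rightarrow> complex" where
  "phi H z =
     (if z = 0 then 1
      else of_real (Gamma (1 - H)) * of_real (z / 4) powr of_real H * exp (\<i> * of_real z / 2)
           * (bessel_J (-H) (of_real z / 2) + \<i> * bessel_J (1 - H) (of_real z / 2)))"

definition dH2 :: "real \<Rightarrow> real" where
  "dH2 H = Gamma (3 / 2 - H) / (2 * H * Gamma (H + 1 / 2) * Gamma (3 - 2 * H))"

definition V :: "real \<Rightarrow> real \<Rightarrow> real" where
  "V H t = dH2 H * t powr (2 - 2 * H)"

text \<open>
  The Lebesgue--Stieltjes integral against \<open>V\<close>. The integrator, given for \<open>t \<ge> 0\<close>, is extended
  by the constant \<open>V H 0 = 0\<close> to the negative half-line, so that \<open>interval_measure\<close> applies;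
  the measure has no mass on the negative half-line and no atom at 0.
\<close>

definition S :: "real \<Rightarrow> real \<Rightarrow> real \<Rightarrow> real \<Rightarrow> complex" where
  "S H T \<omega> l =
     (LINT u:{0..T}|interval_measure (\<lambda>t. V H (max 0 t)). cnj (phi H (u * \<omega>)) * phi H (u * l))"

definition P :: "real \<Rightarrow> real \<Rightarrow> real \<Rightarrow> complex" where
  "P H t l = phi H (t * l) * of_real (sqrt (deriv (V H) t))"

definition P_star :: "real \<Rightarrow> real \<Rightarrow> real \<Rightarrow> complex" where
  "P_star H t l = exp (\<i> * of_real (l * t)) * cnj (P H t l)"

text \<open>
  The branch chosen for the powers is immaterial: the branch factors cancel, also for negative
  arguments, and the exceptional value at 0 is the one given by the entire function.
\<close>

lemma phi_eq_entire:
  assumes "0 < H" "H < 1"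
  shows "phi H z = of_real (Gamma (1 - H) * 2 powr (-H)) * exp (\<i> * of_real z / 2)
           * (bessel_entire (-H) (of_real z / 2)
              + \<i> * (of_real z / 2) * bessel_entire (1 - H) (of_real z / 2))"
proof (cases "z = 0")
  case True
  have G: "Gamma (1 - H) \<noteq> 0"
    using Gamma_real_pos[of "1 - H"] assms by linarith
  have "bessel_entire (-H) 0 = of_real (2 powr H) / of_real (Gamma (1 - H))"
    unfolding bessel_entire_def
    by (subst suminf_finite[of "{0}"]) (auto simp: algebra_simps)
  moreover have "of_real (2 powr (-H)) * of_real (2 powr H) = (1 :: complex)"
    by (metis add.left_inverse of_real_1 of_real_mult powr_add powr_zero_eq_one zero_neq_numeral)
  ultimately show ?thesis
    using True G by (simp add: phi_def mult_ac)
next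
  case False
  define w :: complex where "w = of_real z / 2"
  have w: "w \<noteq> 0" using False by (simp add: w_def)
  have Ln: "Ln (of_real (z / 4)) = Ln w - of_real (ln 2)"
    using Ln_divide_of_real[of 2 w] w by (simp add: w_def)
  have p2: "of_real (2 powr (-H)) = exp (- (of_real H * of_real (ln 2)) :: complex)"
    by (simp add: powr_def exp_of_real flip: of_real_mult of_real_minus)
  have a: "of_real (z / 4) powr of_real H * w powr of_real (-H) = (of_real (2 powr (-H)) :: complex)"
    unfolding p2 using w False
    by (simp add: powr_def Ln [simplified] flip: exp_add) (simp add: algebra_simps)
  have "w powr of_real (1 - H) = w * w powr of_real (-H)"
    using w by (simp add: powr_diff powr_minus divide_inverse)
  then have b: "of_real (z / 4) powr of_real H * w powr of_real (1 - H) = of_real (2 powr (-H)) * w"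
    using a by (simp add: mult_ac)
  have "phi H z = of_real (Gamma (1 - H)) * exp (\<i> * of_real z / 2)
     * (of_real (z / 4) powr of_real H * w powr of_real (-H) * bessel_entire (-H) w
       + \<i> * (of_real (z / 4) powr of_real H * w powr of_real (1 - H)) * bessel_entire (1 - H) w)"
    using False by (simp only: phi_def bessel_J_def w_def if_False) (simp add: algebra_simps)
  also have "\<dots> = of_real (Gamma (1 - H) * 2 powr (-H)) * exp (\<i> * of_real z / 2)
     * (bessel_entire (-H) w + \<i> * w * bessel_entire (1 - H) w)"
    unfolding a b by (simp add: algebra_simps)
  finally show ?thesis by (simp add: w_def)
qed

end

theory Submission
  imports Defs
begin

text \<open>
  For real arguments \<open>\<phi>(2x) = e\<^sup>i\<^sup>x (a(x) + i b(x))\<close> with real \<open>a, b\<close>, and the Bessel recurrences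
  say \<open>a' = -b\<close> and \<open>(x\<^sup>1\<^sup>-\<^sup>2\<^sup>H b)' = x\<^sup>1\<^sup>-\<^sup>2\<^sup>H a\<close>. Writing \<open>a\<^sub>1, b\<^sub>1\<close> and \<open>a\<^sub>2, b\<^sub>2\<close> for the values at
  \<open>u\<omega>/2\<close> and \<open>ul/2\<close>, the integrand of \<open>S\<close> times \<open>i(l - \<omega>)\<close> is therefore the derivative of
  \<open>2i V'(u) e\<^sup>i\<^sup>u\<^sup>(\<^sup>l\<^sup>-\<^sup>\<omega>\<^sup>)\<^sup>/\<^sup>2 (a\<^sub>1 b\<^sub>2 - b\<^sub>1 a\<^sub>2)\<close>, which vanishes at 0 because \<open>b(x) = O(x)\<close>, and which at
  \<open>T\<close> is the right-hand side.
\<close>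

subsection \<open>The real Bessel series\<close>

definition bessel_coeff :: "real \<Rightarrow> nat \<Rightarrow> real" where
  "bessel_coeff \<nu> k = (-1) ^ k * 2 powr (-\<nu>) / (fact k * Gamma (real k + \<nu> + 1))"

text \<open>At w = (x/2)^2 with x > 0 this is x^(-\<nu>) J_\<nu>(x). Taking the square as variable
  gives an ordinary real power series, open to termwise differentiation.\<close>

definition bessel_series :: "real \<Rightarrow> real \<Rightarrow> real" where
  "bessel_series \<nu> w = (\<Sum>k. bessel_coeff \<nu> k * w ^ k)"

lemma bessel_coeff_Suc:
  assumes "-1 < \<nu>"
  shows "bessel_coeff \<nu> (Suc k) = - bessel_coeff \<nu> k / (real (Suc k) * (real k + \<nu> + 1))"
proof -
  have pos: "real k + \<nu> + 1 > 0" using assms by linarith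
  then have "real k + \<nu> + 1 \<notin> \<int>\<^sub>\<le>\<^sub>0" by (auto elim!: nonpos_Ints_cases)
  then have "Gamma (real k + \<nu> + 1 + 1) = (real k + \<nu> + 1) * Gamma (real k + \<nu> + 1)"
    by (rule Gamma_plus1)
  then have "Gamma (real (Suc k) + \<nu> + 1) = (real k + \<nu> + 1) * Gamma (real k + \<nu> + 1)"
    by (simp add: add_ac)
  then show ?thesis
    by (simp add: bessel_coeff_def mult_ac)
qed

lemma summable_bessel_series:
  assumes "-1 < \<nu>"
  shows "summable (\<lambda>k. bessel_coeff \<nu> k * w ^ k)"
\<comment> \<open>The ratio of consecutive terms is |w| / ((n+1)(n+\<nu>+1)) in absolute value. From
  n >= 2|w|+1 the first factor is at least 2|w|; the summand 1 forces n >= 1, so the second factor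
  is at least 1 even for \<nu> close to -1.\<close>
proof (rule summable_ratio_test[where c = "1/2" and N = "nat \<lceil>2 * \<bar>w\<bar>\<rceil> + 1"])
  fix n assume n: "nat \<lceil>2 * \<bar>w\<bar>\<rceil> + 1 \<le> n"
  have pos: "real n + \<nu> + 1 > 0" using assms by linarith
  define d where "d = real (Suc n) * (real n + \<nu> + 1)"
  have "real n \<ge> 2 * \<bar>w\<bar> + 1" using n by linarith
  then have "2 * \<bar>w\<bar> * 1 \<le> real (Suc n) * (real n + \<nu> + 1)"
  proof (intro mult_mono)
    show "1 \<le> real n + \<nu> + 1" using \<open>real n \<ge> 2 * \<bar>w\<bar> + 1\<close> assms by linarith
  qed auto
  then have d: "2 * \<bar>w\<bar> \<le> d" by (simp add: d_def)
  have "d > 0" using pos by (simp add: d_def)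
  have "bessel_coeff \<nu> (Suc n) = - bessel_coeff \<nu> n / d"
    unfolding d_def by (rule bessel_coeff_Suc[OF assms])
  then have "norm (bessel_coeff \<nu> (Suc n) * w ^ Suc n) = (\<bar>w\<bar> / d) * norm (bessel_coeff \<nu> n * w ^ n)"
    using \<open>d > 0\<close> by (simp add: abs_mult)
  also have "\<dots> \<le> 1/2 * norm (bessel_coeff \<nu> n * w ^ n)"
    using d \<open>d > 0\<close> by (intro mult_right_mono) (auto simp: field_simps)
  finally show "norm (bessel_coeff \<nu> (Suc n) * w ^ Suc n) \<le> 1/2 * norm (bessel_coeff \<nu> n * w ^ n)" .
qed simp

lemma bessel_entire_of_real:
  assumes "-1 < \<nu>"
  shows "bessel_entire \<nu> (of_real x) = of_real (bessel_series \<nu> ((x / 2)\<^sup>2))"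
proof -
  have "(\<lambda>k. complex_of_real (bessel_coeff \<nu> k * ((x / 2)\<^sup>2) ^ k)) sums
      of_real (bessel_series \<nu> ((x / 2)\<^sup>2))"
    unfolding bessel_series_def
    by (intro sums_of_real summable_sums summable_bessel_series assms)
  then show ?thesis
    unfolding bessel_entire_def bessel_coeff_def
    by (intro sums_unique[symmetric]) (simp add: power_mult)
qed

text \<open>Differentiation cancels k+1 against the factorial, and a shift of k inside
  \<open>Gamma\<close> equals a shift of \<nu>.\<close>

lemma diffs_bessel_coeff: "diffs (bessel_coeff \<nu>) k = -2 * bessel_coeff (\<nu> + 1) k"
proof -
  have "2 powr (-\<nu>) = 2 * 2 powr (-(\<nu> + 1))"
    by (simp add: powr_diff)
  then show ?thesis
    by (simp add: diffs_def bessel_coeff_def divide_simps add_ac)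
qed

text \<open>The classical (x^(-\<nu>) J_\<nu>)' = -x^(-\<nu>) J_(\<nu>+1) in the variable w =
  (x/2)^2, where dw/dx = x/2.\<close>

lemma DERIV_bessel_series:
  assumes "-1 < \<nu>"
  shows "(bessel_series \<nu> has_real_derivative -2 * bessel_series (\<nu> + 1) w) (at w)"
proof -
  have "(\<Sum>k. diffs (bessel_coeff \<nu>) k * w ^ k) = (\<Sum>k. -2 * (bessel_coeff (\<nu> + 1) k * w ^ k))"
    by (simp add: diffs_bessel_coeff mult_ac)
  also have "\<dots> = -2 * bessel_series (\<nu> + 1) w"
    unfolding bessel_series_def using assms by (intro suminf_mult summable_bessel_series) auto
  finally show ?thesis
    using termdiffs_strong_converges_everywhere[OF summable_bessel_series[OF assms], of w]
    by (simp add: bessel_series_def[abs_def])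
qed

lemma continuous_bessel_series [continuous_intros]:
  assumes "-1 < \<nu>" "continuous_on A f"
  shows "continuous_on A (\<lambda>x. bessel_series \<nu> (f x))"
proof (rule continuous_on_compose2[OF _ assms(2)])
  show "continuous_on UNIV (bessel_series \<nu>)"
    using DERIV_isCont[OF DERIV_bessel_series[OF assms(1)]]
    by (blast intro: continuous_at_imp_continuous_on)
qed simp

text \<open>This is J_(\<nu>-1) + J_(\<nu>+1) = (2\<nu>/x) J_\<nu> multiplied by x^(1-\<nu>), with
  x^2 = 4w. The proof compares coefficients through the functional equation of
  \<open>Gamma\<close>.\<close>

lemma bessel_series_recurrence:
  assumes "0 < \<nu>"
  shows "bessel_series (\<nu> - 1) w = 2 * \<nu> * bessel_series \<nu> w - 4 * w * bessel_series (\<nu> + 1) w"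
proof -
  have "bessel_coeff (\<nu> - 1) k = 2 * (\<nu> + real k) * bessel_coeff \<nu> k" for k
  proof -
    have cancel: "a * (2 * p) / (f * g) = 2 * s * (a * p / (f * (s * g)))"
      if "s > 0" for a p f g s :: real
      using that by simp
    have "\<nu> + real k > 0" using assms by linarith
    then have "\<nu> + real k \<notin> \<int>\<^sub>\<le>\<^sub>0" by (auto elim!: nonpos_Ints_cases)
    then have "Gamma (\<nu> + real k + 1) = (\<nu> + real k) * Gamma (\<nu> + real k)" by (rule Gamma_plus1)
    moreover have "2 powr (- (\<nu> - 1)) = 2 * 2 powr (-\<nu>)"
      by (simp add: powr_diff powr_minus divide_inverse)
    moreover have "real k + \<nu> + 1 = \<nu> + real k + 1" "real k + (\<nu> - 1) + 1 = \<nu> + real k" by simp_all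
    ultimately show ?thesis
      unfolding bessel_coeff_def by (simp only: cancel[OF \<open>\<nu> + real k > 0\<close>])
  qed
  moreover have "real (Suc k) * bessel_coeff \<nu> (Suc k) = -2 * bessel_coeff (\<nu> + 1) k" for k
    using diffs_bessel_coeff[of \<nu> k] by (simp add: diffs_def)
  \<comment> \<open>In the factor 2(\<nu>+k) the part 2k vanishes at k = 0 and otherwise is a
    coefficient of order \<nu>+1 with index lowered by one; hence the split of the head
    term.\<close>
  ultimately have *: "bessel_coeff (\<nu> - 1) 0 = 2 * \<nu> * bessel_coeff \<nu> 0"
    "bessel_coeff (\<nu> - 1) (Suc k) =
       2 * \<nu> * bessel_coeff \<nu> (Suc k) - 4 * bessel_coeff (\<nu> + 1) k" for k
    by (simp_all add: algebra_simps)
  have sm: "summable (\<lambda>k. bessel_coeff \<mu> k * w ^ k)" if "\<mu> \<ge> \<nu> - 1" for \<mu>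
    using that assms by (intro summable_bessel_series) linarith
  have split: "bessel_series \<mu> w = bessel_coeff \<mu> 0 + (\<Sum>k. bessel_coeff \<mu> (Suc k) * w ^ Suc k)"
    if "\<mu> \<ge> \<nu> - 1" for \<mu>
    unfolding bessel_series_def using suminf_split_head[OF sm[OF that]] by simp
  have "(\<Sum>k. bessel_coeff (\<nu> - 1) (Suc k) * w ^ Suc k) =
      (\<Sum>k. 2 * \<nu> * (bessel_coeff \<nu> (Suc k) * w ^ Suc k)
        - 4 * w * (bessel_coeff (\<nu> + 1) k * w ^ k))"
    by (simp add: * algebra_simps)
  also have "\<dots> = 2 * \<nu> * (\<Sum>k. bessel_coeff \<nu> (Suc k) * w ^ Suc k) - 4 * w * bessel_series (\<nu> + 1) w"
  proof -
    have s1: "summable (\<lambda>k. bessel_coeff \<nu> (Suc k) * w ^ Suc k)"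
      using sm[of \<nu>] by (subst summable_Suc_iff) auto
    have s2: "summable (\<lambda>k. bessel_coeff (\<nu> + 1) k * w ^ k)"
      using sm[of "\<nu> + 1"] by auto
    show ?thesis
      unfolding bessel_series_def
      by (subst suminf_diff[symmetric] suminf_mult[OF s1] suminf_mult[OF s2];
          (intro summable_mult s1 s2)?)+ simp
  qed
  finally show ?thesis
    by (simp add: split[of "\<nu> - 1"] split[of \<nu>] * algebra_simps)
qed

subsection \<open>Real components of \<open>\<phi>\<close>\<close>

text \<open>For x > 0, \<open>phi_even\<close> and \<open>phi_odd\<close> are \<Gamma>(1-H) 2^(-H)
  times x^H J_(-H)(x) and x^H J_(1-H)(x). They are the a and b of the outline; the series form
  covers x <= 0 without powers of negative numbers.\<close>

definition phi_even :: "real \<Rightarrow> real \<Rightarrow> real" where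
  "phi_even H x = Gamma (1 - H) * 2 powr (-H) * bessel_series (-H) ((x / 2)\<^sup>2)"

definition phi_odd :: "real \<Rightarrow> real \<Rightarrow> real" where
  "phi_odd H x = Gamma (1 - H) * 2 powr (-H) * (x * bessel_series (1 - H) ((x / 2)\<^sup>2))"

lemma phi_eq_even_odd:
  assumes "0 < H" "H < 1"
  shows "phi H z = exp (\<i> * of_real z / 2) * (of_real (phi_even H (z / 2)) + \<i> * of_real (phi_odd H (z / 2)))"
proof -
  have "bessel_entire \<nu> (of_real z / 2) = of_real (bessel_series \<nu> ((z / 4)\<^sup>2))" if "-1 < \<nu>" for \<nu>
    using bessel_entire_of_real[OF that, of "z / 2"] by simp
  then show ?thesis
    using assms by (simp add: phi_eq_entire phi_even_def phi_odd_def algebra_simps)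
qed

lemma DERIV_phi_even:
  assumes "H < 1"
  shows "(phi_even H has_real_derivative - phi_odd H x) (at x)"
proof -
  have "((\<lambda>x. (x / 2)\<^sup>2) has_real_derivative x / 2) (at x)"
    by (auto intro!: derivative_eq_intros)
  then have "((\<lambda>x. bessel_series (-H) ((x / 2)\<^sup>2)) has_real_derivative
      -2 * bessel_series (-H + 1) ((x / 2)\<^sup>2) * (x / 2)) (at x)"
    using assms by (intro DERIV_chain2[OF DERIV_bessel_series]) simp_all
  then show ?thesis
    unfolding phi_even_def[abs_def] phi_odd_def
    by (rule DERIV_cong[OF DERIV_cmult]) simp
qed

text \<open>At s = 1 this is (x^\<mu> J_\<mu>)' = x^\<mu> J_(\<mu>-1) for \<mu> = 1-H, up to a
  constant. The scale s stays outside the weight, so one weight, proportional to V', serves both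
  frequencies, whatever their signs.\<close>

lemma DERIV_phi_odd:
  assumes "H < 1" "u > 0"
  shows "((\<lambda>u. u powr (1 - 2 * H) * phi_odd H (u * s)) has_real_derivative
           u powr (1 - 2 * H) * (s * phi_even H (u * s))) (at u)"
proof -
  define c where "c = Gamma (1 - H) * 2 powr (-H)"
  define w where "w = (u * s / 2)\<^sup>2"
  have p: "u powr (2 - 2 * H) = u * u powr (1 - 2 * H)"
    using assms powr_add[of u 1 "1 - 2 * H"] by simp
  have sq: "((\<lambda>u. (u * s / 2)\<^sup>2) has_real_derivative s / 2 * (u * s)) (at u)"
    by (auto intro!: derivative_eq_intros simp: power2_eq_square)
  have J: "((\<lambda>u. bessel_series (1 - H) ((u * s / 2)\<^sup>2)) has_real_derivative
      -2 * bessel_series (1 - H + 1) w * (s / 2 * (u * s))) (at u)"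
    unfolding w_def using assms by (intro DERIV_chain2[OF DERIV_bessel_series sq]) simp
  have pw: "((\<lambda>u. u powr (2 - 2 * H)) has_real_derivative (2 - 2 * H) * u powr (1 - 2 * H)) (at u)"
    using has_real_derivative_powr[OF assms(2), of "2 - 2 * H"] by simp
  \<comment> \<open>The recurrence trades order -H for the orders 1-H and 2-H that the product rule
    produces.\<close>
  have "bessel_series (-H) w =
      2 * (1 - H) * bessel_series (1 - H) w - 4 * w * bessel_series (1 - H + 1) w"
    using bessel_series_recurrence[of "1 - H" w] assms by simp
  then have "u powr (1 - 2 * H) * (s * phi_even H (u * s)) = c * s *
      (u powr (2 - 2 * H) * (-2 * bessel_series (1 - H + 1) w * (s / 2 * (u * s)))
        + (2 - 2 * H) * u powr (1 - 2 * H) * bessel_series (1 - H) w)"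
    by (simp add: phi_even_def p flip: c_def w_def) (simp add: w_def power2_eq_square algebra_simps)
  then have "((\<lambda>u. c * s * (u powr (2 - 2 * H) * bessel_series (1 - H) ((u * s / 2)\<^sup>2))) has_real_derivative
          u powr (1 - 2 * H) * (s * phi_even H (u * s))) (at u)"
    using DERIV_cmult[OF DERIV_mult'[OF pw J], of "c * s"] by (simp only: w_def)
  then show ?thesis
  proof (rule has_field_derivative_transform_within_open[where S = "{0<..}"])
    fix u :: real assume "u \<in> {0<..}"
    then have "u powr (2 - 2 * H) = u * u powr (1 - 2 * H)"
      using powr_add[of u 1 "1 - 2 * H"] by simp
    then show "c * s * (u powr (2 - 2 * H) * bessel_series (1 - H) ((u * s / 2)\<^sup>2)) =
        u powr (1 - 2 * H) * phi_odd H (u * s)"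
      by (simp add: phi_odd_def c_def)
  qed (use assms in auto)
qed

lemma continuous_phi_even [continuous_intros]:
  assumes "H < 1" "continuous_on A f"
  shows "continuous_on A (\<lambda>x. phi_even H (f x))"
  unfolding phi_even_def using assms by (intro continuous_intros) auto

lemma continuous_phi_odd [continuous_intros]:
  assumes "H < 1" "continuous_on A f"
  shows "continuous_on A (\<lambda>x. phi_odd H (f x))"
  unfolding phi_odd_def using assms by (intro continuous_intros) auto

lemma continuous_phi:
  assumes "0 < H" "H < 1"
  shows "continuous_on A (\<lambda>u. phi H (u * s))"
  unfolding phi_eq_even_odd[OF assms] using assms by (intro continuous_intros) auto

subsection \<open>The Stieltjes measure of \<open>V\<close>\<close>

text \<open>Puts continuity into the form of the endpoint limits that the fundamental theorem for
  interval integrals asks for.\<close>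

lemma continuous_on_UNIV_tendsto_ereal:
  fixes F :: "real \<Rightarrow> 'a::topological_space"
  assumes "continuous_on UNIV F"
  shows "((F \<circ> real_of_ereal) \<longlongrightarrow> F x) (at_right (ereal x))"
    and "((F \<circ> real_of_ereal) \<longlongrightarrow> F x) (at_left (ereal x))"
  using assms by (auto simp: ereal_tendsto_simps continuous_on_def filterlim_at_split)

text \<open>Both measures agree on half-open intervals, which generate the Borel sets. The
  derivative is controlled only on the open half-line, since V' blows up at 0 when H > 1/2.\<close>

lemma interval_measure_eq_density:
  fixes F f :: "real \<Rightarrow> real"
  assumes mono: "mono F" and cont: "continuous_on UNIV F" and flat: "\<And>x. x \<le> 0 \<Longrightarrow> F x = F 0"
    and deriv: "\<And>x. x > 0 \<Longrightarrow> (F has_real_derivative f x) (at x)"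
    and f_cont: "\<And>x. x > 0 \<Longrightarrow> isCont f x" and f_nonneg: "\<And>x. x > 0 \<Longrightarrow> f x \<ge> 0"
    and [measurable]: "f \<in> borel_measurable borel"
  shows "interval_measure F = density lborel (\<lambda>x. ennreal (indicator {0<..} x * f x))"
proof (rule measure_eqI_generator_eq[where \<Omega> = UNIV
        and E = "range (\<lambda>(a, b). {a <.. b::real})" and A = "\<lambda>n. {- real n <.. real n}"])
  have Ioc: "emeasure (interval_measure F) {a<..b} = ennreal (F b - F a)" if "a \<le> b" for a b
    using that monoD[OF mono] cont
    by (intro emeasure_interval_measure_Ioc)
       (auto simp: continuous_on_eq_continuous_at intro: continuous_at_imp_continuous_at_within)
  show "Int_stable (range (\<lambda>(a, b). {a <.. b::real}))"
    by (auto simp: Int_stable_def image_iff)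
  show "emeasure (interval_measure F) X =
      emeasure (density lborel (\<lambda>x. ennreal (indicator {0<..} x * f x))) X"
    if "X \<in> range (\<lambda>(a, b). {a <.. b::real})" for X
  proof -
    from that obtain a b where X: "X = {a<..b}" by auto
    \<comment> \<open>\<open>F\<close> is constant and the density zero left of 0, so cutting the
      interval at 0 changes neither side.\<close>
    define a' where "a' = max 0 a"
    have "0 \<le> a'" by (simp add: a'_def)
    have Fa: "F a' = F a" using flat[of a] by (auto simp: a'_def max_def)
    have den: "emeasure (density lborel (\<lambda>x. ennreal (indicator {0<..} x * f x))) X =
        (\<integral>\<^sup>+x. ennreal (indicator {a'<..b} x * f x) \<partial>lborel)"
      unfolding X a'_def
      by (subst emeasure_density) (auto intro!: nn_integral_cong simp: indicator_def)
    show ?thesis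
    proof (cases "a' < b")
      case True
      note lim = continuous_on_UNIV_tendsto_ereal[OF cont]
      have "AE x in lborel. ereal a' < ereal x \<longrightarrow> ereal x < ereal b \<longrightarrow> 0 \<le> f x"
        using f_nonneg by (auto simp: a'_def)
      \<comment> \<open>For a nonnegative derivative, limits of the primitive at the endpoints
        suffice and integrability is a conclusion; this admits a' = 0, where \<open>f\<close> may be
        unbounded.\<close>
      note FTC = interval_integral_FTC_nonneg[of a' b F f "F a'" "F b", OF _ _ _ this lim]
      have int: "set_integrable lborel {a'<..<b} f" "(LBINT x=a'..b. f x) = F b - F a'"
        using FTC True deriv f_cont \<open>0 \<le> a'\<close> by auto
      have "(\<integral>\<^sup>+x. ennreal (indicator {a'<..b} x * f x) \<partial>lborel) =
          (\<integral>\<^sup>+x. ennreal (indicator {a'<..<b} x * f x) \<partial>lborel)"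
        using AE_lborel_singleton[of b]
        by (intro nn_integral_cong_AE) (auto elim!: eventually_mono simp: indicator_def)
      also have "\<dots> = ennreal (LBINT x=a'..b. f x)"
        using int(1) True f_nonneg
        by (subst nn_integral_eq_integral)
           (auto simp: set_integrable_def interval_lebesgue_integral_def set_lebesgue_integral_def
              indicator_def \<open>0 \<le> a'\<close> intro!: AE_I2 order.strict_trans1[OF \<open>0 \<le> a'\<close>])
      finally show ?thesis
        using True Ioc[of a b] unfolding den int(2) Fa by (simp add: X a'_def)
    next
      \<comment> \<open>The interval is empty or lies left of 0; \<open>ennreal\<close> cuts the
        nonpositive increment to 0.\<close>
      case False
      then have "F b \<le> F a'" using monoD[OF mono, of b a'] by simp
      then have "emeasure (interval_measure F) X = 0"
        using Fa Ioc[of a b] X by (cases "a \<le> b") (auto simp: ennreal_neg)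
      moreover have "(\<integral>\<^sup>+x. ennreal (indicator {a'<..b} x * f x) \<partial>lborel) = 0"
        using False by simp
      ultimately show ?thesis by (simp add: den)
    qed
  qed
  show "emeasure (interval_measure F) {- real n <.. real n} \<noteq> \<infinity>" for n
    by (subst Ioc) auto
  show "(\<Union>n. {- real n <.. real n}) = UNIV"
  proof (intro equalityI subsetI UNIV_I)
    fix x :: real
    obtain n where "\<bar>x\<bar> < real n" using reals_Archimedean2 by blast
    then show "x \<in> (\<Union>n. {- real n <.. real n})" by (intro UN_I[of n]) auto
  qed
qed (auto simp: borel_sigma_sets_Ioc)

lemma dH2_pos:
  assumes "0 < H" "H < 1"
  shows "dH2 H > 0"
  using assms Gamma_real_pos[of "3/2 - H"] Gamma_real_pos[of "H + 1/2"] Gamma_real_pos[of "3 - 2 * H"]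
  by (auto simp: dH2_def intro!: divide_pos_pos mult_pos_pos)

definition V_density :: "real \<Rightarrow> real \<Rightarrow> real" where
  "V_density H t = dH2 H * (2 - 2 * H) * t powr (1 - 2 * H)"

lemma DERIV_V:
  assumes "t > 0"
  shows "(V H has_real_derivative V_density H t) (at t)"
  unfolding V_def[abs_def] V_density_def
  using DERIV_cmult[OF has_real_derivative_powr[OF assms, of "2 - 2 * H"], of "dH2 H"]
  by (simp add: mult_ac)

lemma V_density_nonneg:
  assumes "0 < H" "H < 1"
  shows "V_density H t \<ge> 0"
  using dH2_pos[OF assms] assms by (simp add: V_density_def)

lemma isCont_V_density: "t > 0 \<Longrightarrow> isCont (V_density H) t"
  unfolding V_density_def[abs_def] by (intro continuous_intros) auto

lemma borel_measurable_V_density [measurable]: "V_density H \<in> borel_measurable borel"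
  unfolding V_density_def[abs_def] by measurable

lemma continuous_V_max:
  assumes "H < 1"
  shows "continuous_on UNIV (\<lambda>t. V H (max 0 t))"
  unfolding V_def using assms by (intro continuous_intros continuous_on_powr') auto

lemma DERIV_V_max:
  assumes "t > 0"
  shows "((\<lambda>t. V H (max 0 t)) has_real_derivative V_density H t) (at t)"
  by (rule has_field_derivative_transform_within_open[OF DERIV_V[OF assms], where S = "{0<..}"])
     (use assms in auto)

lemma interval_measure_V:
  assumes "0 < H" "H < 1"
  shows "interval_measure (\<lambda>t. V H (max 0 t)) =
    density lborel (\<lambda>x. ennreal (indicator {0<..} x * V_density H x))"
proof (rule interval_measure_eq_density)
  show "mono (\<lambda>t. V H (max 0 t))"
    unfolding V_def using assms dH2_pos[OF assms]
    by (intro monoI mult_left_mono powr_mono2) auto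
qed (use assms in \<open>auto intro: continuous_V_max DERIV_V_max isCont_V_density V_density_nonneg\<close>)

text \<open>The singularity at 0 for H > 1/2 is integrable because the nonnegative density has a
  primitive with finite limits at both ends.\<close>

lemma set_integrable_V_density:
  assumes "0 < H" "H < 1" "0 < T"
  shows "set_integrable lborel {0<..<T} (V_density H)"
proof -
  note lim = continuous_on_UNIV_tendsto_ereal[OF continuous_V_max[OF assms(2)]]
  show ?thesis
    using interval_integral_FTC_nonneg(1)[of 0 T "\<lambda>t. V H (max 0 t)" "V_density H", OF _ _ _ _
        lim(1)[of 0, folded zero_ereal_def] lim(2)[of T]]
      assms DERIV_V_max isCont_V_density V_density_nonneg by (auto simp: zero_ereal_def)
qed

section \<open>Closed form of the integral over [0,T]\<close>

lemma S_eq_interval_integral: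
  assumes "0 < H" "H < 1" "0 < T"
  shows "S H T \<omega> l = (LBINT u=0..T. V_density H u *\<^sub>R (cnj (phi H (u * \<omega>)) * phi H (u * l)))"
proof -
  have [measurable]: "(\<lambda>u. phi H (u * s)) \<in> borel_measurable borel" for s
    by (rule borel_measurable_continuous_onI[OF continuous_phi[OF assms(1,2)]])
  have [measurable]: "(\<lambda>u. cnj (phi H (u * s))) \<in> borel_measurable borel" for s
    by (intro borel_measurable_continuous_onI continuous_intros continuous_phi assms)
  have "S H T \<omega> l = (LINT u|lborel. (indicator {0<..} u * V_density H u) *\<^sub>R
      indicator {0..T} u *\<^sub>R (cnj (phi H (u * \<omega>)) * phi H (u * l)))"
    unfolding S_def interval_measure_V[OF assms(1,2)] set_lebesgue_integral_def
    using V_density_nonneg[OF assms(1,2)] by (subst integral_density) auto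
  \<comment> \<open>The indicator in the density removes the point 0.\<close>
  also have "\<dots> = (LBINT u:{0<..T}. V_density H u *\<^sub>R (cnj (phi H (u * \<omega>)) * phi H (u * l)))"
    unfolding set_lebesgue_integral_def
    by (intro Bochner_Integration.integral_cong) (auto simp: indicator_def)
  finally show ?thesis
    using assms by (simp add: interval_integral_Ioc zero_ereal_def)
qed

text \<open>Multiplying by \<open>l - \<omega>\<close> instead of dividing keeps the case l =
  \<omega> without a separate argument.\<close>

lemma phi_integral:
  assumes "0 < H" "H < 1" "0 < T"
  shows "of_real (l - \<omega>) * (LBINT u=0..T. V_density H u *\<^sub>R (cnj (phi H (u * \<omega>)) * phi H (u * l))) =
    2 * of_real (V_density H T) * exp (\<i> * of_real (T * (l - \<omega>)) / 2) *
      of_real (phi_even H (T * \<omega> / 2) * phi_odd H (T * l / 2)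
        - phi_odd H (T * \<omega> / 2) * phi_even H (T * l / 2))"
proof -
  define a where "a s u = phi_even H (u * (s / 2))" for s u
  define b where "b s u = phi_odd H (u * (s / 2))" for s u
  define q where "q u = u powr (1 - 2 * H)" for u
  define K where "K = dH2 H * (2 - 2 * H)"
  have Vd: "V_density H u = K * q u" for u by (simp add: V_density_def K_def q_def)
  define e where "e u = exp (\<i> * of_real (l - \<omega>) / 2 * of_real u)" for u :: real
  define W where "W u = a \<omega> u * (q u * b l u) - (q u * b \<omega> u) * a l u" for u
  define F where "F u = 2 * of_real K * (e u * of_real (W u))" for u
  define g where "g u = V_density H u *\<^sub>R (cnj (phi H (u * \<omega>)) * phi H (u * l))" for u
  have g_eq: "g u = of_real K * (e u * of_real (q u) *
      Complex (a \<omega> u * a l u + b \<omega> u * b l u) (a \<omega> u * b l u - b \<omega> u * a l u))" for u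
  proof -
    have "cnj (exp (\<i> * of_real (u * \<omega>) / 2)) * exp (\<i> * of_real (u * l) / 2) = e u"
      by (simp add: e_def exp_cnj flip: exp_add) (simp add: algebra_simps diff_divide_distrib)
    moreover have "cnj (of_real (a \<omega> u) + \<i> * of_real (b \<omega> u)) * (of_real (a l u) + \<i> * of_real (b l u))
       = Complex (a \<omega> u * a l u + b \<omega> u * b l u) (a \<omega> u * b l u - b \<omega> u * a l u)"
      by (simp add: complex_eq_iff)
    moreover have "g u = of_real (K * q u) *
       ((cnj (exp (\<i> * of_real (u * \<omega>) / 2)) * exp (\<i> * of_real (u * l) / 2)) *
        (cnj (of_real (a \<omega> u) + \<i> * of_real (b \<omega> u)) * (of_real (a l u) + \<i> * of_real (b l u))))"
      unfolding g_def phi_eq_even_odd[OF assms(1,2)] Vd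
      by (simp only: a_def b_def scaleR_conv_of_real complex_cnj_mult mult_ac times_divide_eq_right)
    ultimately show ?thesis by (simp add: mult_ac)
  qed
  \<comment> \<open>\<open>W\<close> pairs \<open>q\<close> with \<open>b\<close>, as
    \<open>q * b\<close> has a simple derivative. The products \<open>a * a\<close> and
    \<open>b * b\<close> each occur once with l/2 and once with -\<omega>/2.\<close>
  have dW: "(W has_real_derivative q u * ((l - \<omega>) / 2 * (a \<omega> u * a l u + b \<omega> u * b l u))) (at u)"
    if "u > 0" for u
  proof -
    have da: "(a s has_real_derivative - (s / 2 * b s u)) (at u)" for s
      unfolding a_def[abs_def] b_def
      using DERIV_chain2[OF DERIV_phi_even DERIV_cmult_right[OF DERIV_ident, of "s / 2"],
          OF assms(2), of u] by (simp add: mult_ac)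
    have db: "((\<lambda>u. q u * b s u) has_real_derivative q u * (s / 2 * a s u)) (at u)" for s
      unfolding a_def b_def q_def using assms that by (intro DERIV_phi_odd)
    show ?thesis
      unfolding W_def[abs_def]
      by (rule derivative_eq_intros da db refl)+ (simp add: field_simps)
  qed
  have e': "(e has_vector_derivative \<i> * of_real (l - \<omega>) / 2 * e u) (at u)" for u
    unfolding e_def[abs_def]
    by (rule has_vector_derivative_real_field) (auto intro!: derivative_eq_intros)
  have dF: "(F has_vector_derivative of_real (l - \<omega>) * g u) (at u)" if "u > 0" for u
  proof -
    have "(F has_vector_derivative 2 * of_real K * (e u *
        of_real (q u * ((l - \<omega>) / 2 * (a \<omega> u * a l u + b \<omega> u * b l u)))
        + \<i> * of_real (l - \<omega>) / 2 * e u * of_real (W u))) (at u)"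
      unfolding F_def[abs_def]
      by (intro has_vector_derivative_mult_right has_vector_derivative_mult e'
          has_vector_derivative_of_real dW that)
    \<comment> \<open>The derivative of \<open>W\<close> yields the real part of the
      \<open>Complex\<close> factor in \<open>g_eq\<close>, that of \<open>e\<close> the imaginary
      part; the 2 in \<open>F\<close> clears the halves.\<close>
    moreover have "2 * of_real K * (e u *
        of_real (q u * ((l - \<omega>) / 2 * (a \<omega> u * a l u + b \<omega> u * b l u)))
        + \<i> * of_real (l - \<omega>) / 2 * e u * of_real (W u)) = of_real (l - \<omega>) * g u"
      unfolding g_eq W_def Complex_eq by (simp add: field_simps)
    ultimately show ?thesis by simp
  qed
  have cont_phi: "continuous_on A (\<lambda>u. cnj (phi H (u * \<omega>)) * phi H (u * l))" for A
    by (intro continuous_intros continuous_phi assms)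
  have g_cont: "isCont (\<lambda>u. of_real (l - \<omega>) * g u) u" if "u > 0" for u
  proof -
    have "isCont (\<lambda>u. phi H (u * s)) u" for s
      using continuous_phi[OF assms(1,2), of UNIV s] by (simp add: continuous_on_eq_continuous_at)
    then show ?thesis
      unfolding g_def by (intro continuous_intros isCont_V_density that)
  qed
  \<comment> \<open>\<open>g\<close> is the integrable density times a function bounded on the
    compact interval.\<close>
  have g_int: "set_integrable lborel {0<..<T} g"
  proof -
    have "compact ((\<lambda>u. cnj (phi H (u * \<omega>)) * phi H (u * l)) ` {0..T})"
      by (intro compact_continuous_image cont_phi compact_Icc)
    then obtain B where B: "norm (cnj (phi H (u * \<omega>)) * phi H (u * l)) \<le> B" if "u \<in> {0..T}" for u
      by (force dest!: compact_imp_bounded simp: bounded_iff)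
    have [measurable]: "(\<lambda>u. cnj (phi H (u * \<omega>)) * phi H (u * l)) \<in> borel_measurable borel"
      by (rule borel_measurable_continuous_onI[OF cont_phi])
    have "set_integrable lborel {0<..<T} (\<lambda>u. B * V_density H u)"
      by (intro set_integrable_mult_right set_integrable_V_density assms)
    then show ?thesis
    proof (rule set_integrable_bound)
      show "set_borel_measurable lborel {0<..<T} g"
        unfolding g_def set_borel_measurable_def by measurable
      show "AE u in lborel. u \<in> {0<..<T} \<longrightarrow> norm (g u) \<le> norm (B * V_density H u)"
      proof (intro AE_I2 impI)
        fix u assume "u \<in> {0<..<T}"
        then have "norm (g u) \<le> V_density H u * B"
          using B[of u] V_density_nonneg[OF assms(1,2), of u]
          by (auto simp: g_def intro!: mult_left_mono)
        then show "norm (g u) \<le> norm (B * V_density H u)"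
          by (simp add: mult.commute)
      qed
    qed
  qed
  have "(LBINT u=0..T. of_real (l - \<omega>) * g u) = F T - 0"
  proof (rule interval_integral_FTC_integrable)
    show "set_integrable lborel (einterval 0 (ereal T)) (\<lambda>u. of_real (l - \<omega>) * g u)"
      using g_int by (simp add: zero_ereal_def)
    show "((F \<circ> real_of_ereal) \<longlongrightarrow> F T) (at_left (ereal T))"
      using has_vector_derivative_continuous[OF dF[OF assms(3)]]
      by (simp add: ereal_tendsto_simps continuous_within tendsto_within_subset
          filterlim_at_split)
    \<comment> \<open>Near 0 the weight u^(1-2H) may blow up. Since b = u h, one factor u moves into
      the weight, whose exponent 2-2H is positive; the resulting \<open>F'\<close> is continuous up
      to 0 and vanishes there.\<close>
    define c where "c = Gamma (1 - H) * 2 powr (-H)"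
    define h where "h s u = c * (s / 2 * bessel_series (1 - H) ((u * (s / 2) / 2)\<^sup>2))" for s u
    define F' where "F' u = 2 * of_real K * (e u * of_real
       (u powr (2 - 2 * H) * (a \<omega> u * h l u - h \<omega> u * a l u)))" for u :: real
    have "continuous_on {0..} (h s)" for s
      unfolding h_def[abs_def] using assms by (intro continuous_intros) auto
    then have "continuous_on {0..} F'"
      unfolding F'_def[abs_def] e_def a_def using assms
      by (intro continuous_intros continuous_on_powr') auto
    then have "(F' \<longlongrightarrow> F' 0) (at_right 0)"
      by (auto simp: continuous_on_def intro: tendsto_within_subset)
    moreover have "eventually (\<lambda>u. F' u = F u) (at_right 0)"
      using eventually_at_right_less[of 0]
    proof eventually_elim
      case (elim u)
      then have "u powr (2 - 2 * H) = u * u powr (1 - 2 * H)"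
        using powr_add[of u 1 "1 - 2 * H"] by simp
      then show ?case
        by (simp add: F_def F'_def W_def b_def phi_odd_def h_def q_def c_def field_simps)
    qed
    ultimately have "(F \<longlongrightarrow> 0) (at_right 0)"
      using tendsto_cong by (fastforce simp: F'_def)
    then show "((F \<circ> real_of_ereal) \<longlongrightarrow> 0) (at_right 0)"
      by (simp add: zero_ereal_def ereal_tendsto_simps)
  qed (use assms dF g_cont in \<open>auto simp: zero_ereal_def\<close>)
  then have "of_real (l - \<omega>) * (LBINT u=0..T. g u) = F T"
    by simp
  then show ?thesis
    unfolding g_def F_def Vd W_def a_def b_def e_def
    by (simp add: algebra_simps)
qed

section \<open>Comparison with the boundary terms at T\<close>

theorem theorem6p1:
  fixes H T \<omega> l :: real
  assumes "0 < H" and "H < 1" and "0 < T"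
  shows "\<i> * of_real (l - \<omega>) * S H T \<omega> l
           = cnj (P H T \<omega>) * P H T l - cnj (P_star H T \<omega>) * P_star H T l"
proof -
  define r where "r = sqrt (V_density H T)"
  have r: "of_real (V_density H T) = of_real r * (of_real r :: complex)"
    using V_density_nonneg[OF assms(1,2)] by (simp add: r_def flip: of_real_mult)
  define a where "a s = complex_of_real (phi_even H (T * s / 2))" for s
  define b where "b s = complex_of_real (phi_odd H (T * s / 2))" for s
  define e where "e s = exp (\<i> * of_real (T * s) / 2)" for s
  have [simp]: "cnj (a s) = a s" "cnj (b s) = b s" for s by (simp_all add: a_def b_def)
  have ce: "cnj (e s) * e s = 1" for s
    by (simp add: e_def exp_cnj flip: exp_add)
  have P: "P H T s = e s * (a s + \<i> * b s) * of_real r" for s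
    using DERIV_imp_deriv[OF DERIV_V[OF assms(3)]]
    by (simp add: P_def r_def phi_eq_even_odd[OF assms(1,2)] a_def b_def e_def)
  \<comment> \<open>Conjugation inverts the phase \<open>e s\<close> and the factor exp(isT)
    restores it, so \<open>P_star\<close> differs from \<open>P\<close> only in the sign of
    \<open>b\<close>.\<close>
  have Ps: "P_star H T s = e s * (a s - \<i> * b s) * of_real r" for s
  proof -
    have "exp (\<i> * of_real (s * T)) = e s * e s"
      by (simp add: e_def mult.commute flip: exp_add)
    then have "P_star H T s = e s * (cnj (e s) * e s) * (a s - \<i> * b s) * of_real r"
      by (simp add: P_star_def P)
    then show ?thesis by (simp add: ce)
  qed
  have "e (l - \<omega>) = cnj (e \<omega>) * e l"
    by (simp add: e_def exp_cnj flip: exp_add) (simp add: algebra_simps diff_divide_distrib)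
  then have "\<i> * of_real (l - \<omega>) * S H T \<omega> l = \<i> * (2 * (of_real r * of_real r) * (cnj (e \<omega>) * e l) *
      (a \<omega> * b l - b \<omega> * a l))"
    using phi_integral[OF assms, of l \<omega>]
    by (simp add: S_eq_interval_integral[OF assms] mult.assoc r a_def b_def e_def)
  \<comment> \<open>In the difference the terms \<open>a * a\<close> and \<open>b * b\<close>
    cancel, while the mixed terms double to 2i(a b - b a), taken at \<omega> and l in this
    order.\<close>
  then show ?thesis
    by (simp add: P Ps algebra_simps)
qed

end
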